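(* Every non-noetherian valuation ring is an MTL-ring which is not a BL-ring.
   Context: A valuation ring is a commutative ring with identity whose ideals are totally ordered by inclusion (zero divisors are allowed). For ideals $I,J$ of a commutative ring $R$, write $I\rightarrow J=\{x\in R : xI\subseteq J\}$. A commutative ring $R$ such that for every $x\in R$ there is $r\in R$ with $x=rx$ (automatic if $R$ has an identity) is called an MTL-ring if $(I\rightarrow J)+(J\rightarrow I)=R$ for all ideals $I,J$ of $R$. It is called a BL-ring if its ideals form a BL-algebra (with meet $\cap$, join $+$, product of ideals, and residuum $\rightarrow$), i.e. if it is an MTL-ring and moreover $I\cap J=I\cdot(I\rightarrow J)$ for all ideals $I,J$ of $R$. *)

theory Defs
  imports "HOL-Algebra.Algebra"
begin

definition ideal_residuum :: "('a, 'm) ring_scheme \<Rightarrow> 'a set \<Rightarrow> 'a set \<Rightarrow> 'a set"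
    (infixr "\<rightharpoonup>\<index>" 85)
  where "I \<rightharpoonup>\<^bsub>R\<^esub> J = {x \<in> carrier R. \<forall>a \<in> I. x \<otimes>\<^bsub>R\<^esub> a \<in> J}"

(* Zero divisors are allowed: this is not a locale of domains. *)
locale valuation_ring = cring R for R (structure) +
  assumes ideals_total: "\<lbrakk> ideal I R; ideal J R \<rbrakk> \<Longrightarrow> I \<subseteq> J \<or> J \<subseteq> I"

(* The notion of an MTL-ring also makes sense for commutative rings without identity, where
   local_unit is a genuine condition.  Library rings have an identity, so here it is automatic. *)
locale MTL_ring = cring R for R (structure) +
  assumes local_unit: "x \<in> carrier R \<Longrightarrow> \<exists>r \<in> carrier R. x = r \<otimes> x"
    and prelinear: "\<lbrakk> ideal I R; ideal J R \<rbrakk> \<Longrightarrow> set_add R (I \<rightharpoonup> J) (J \<rightharpoonup> I) = carrier R"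

locale BL_ring = MTL_ring R for R (structure) +
  assumes divisible: "\<lbrakk> ideal I R; ideal J R \<rbrakk> \<Longrightarrow> I \<inter> J = I \<cdot> (I \<rightharpoonup> J)"

end

theory Submission
  imports Defs
begin

text \<open>Prelinearity is immediate: of two comparable ideals, one residuates into the other with residuum
  the whole ring. If the ring is not noetherian, some ideal \<open>I\<close> is not principal; pick a nonzero
  \<open>a\<close> in \<open>I\<close>. Divisibility would give \<open>a = i k\<close> with \<open>i\<close> in \<open>I\<close> and \<open>k I\<close> inside the ideal of \<open>a\<close>. As
  \<open>I\<close> is not principal, \<open>i = j m\<close> with \<open>j\<close> in \<open>I\<close> and \<open>m\<close> a nonunit, and \<open>k j = a r\<close>, so
  \<open>a = a (m r)\<close>. The ring is local, so \<open>1 - m r\<close> is a unit and \<open>a = 0\<close>.\<close>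

lemma (in cring) ideal_residuum_ideal:
  assumes I: "ideal I R" and J: "ideal J R"
  shows "ideal (I \<rightharpoonup> J) R"
proof (rule idealI)
  interpret I: ideal I R by fact
  interpret J: ideal J R by fact
  show "ring R" by (rule ring_axioms)
  show "subgroup (I \<rightharpoonup> J) (add_monoid R)"
    by (rule add.subgroupI)
       (auto simp: ideal_residuum_def I.Icarr l_distr l_minus intro!: exI[of _ \<zero>])
  fix a x assume ax: "a \<in> I \<rightharpoonup> J" "x \<in> carrier R"
  then show "x \<otimes> a \<in> I \<rightharpoonup> J"
    by (auto simp: ideal_residuum_def I.Icarr m_assoc J.I_l_closed)
  then show "a \<otimes> x \<in> I \<rightharpoonup> J"
    using ax by (auto simp: ideal_residuum_def m_comm)
qed

context valuation_ring
begin

lemma MTL_ring: "MTL_ring R"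
proof unfold_locales
  fix x assume "x \<in> carrier R"
  then show "\<exists>r \<in> carrier R. x = r \<otimes> x"
    by (intro bexI[of _ \<one>]) auto
next
  have residuum_closed: "I \<rightharpoonup> J \<subseteq> carrier R" for I J
    by (auto simp: ideal_residuum_def)
  have residuum_top: "I \<rightharpoonup> J = carrier R" if "ideal J R" "I \<subseteq> J" for I J
    using that by (auto simp: ideal_residuum_def intro: ideal.I_l_closed)
  \<comment> \<open>Supplies the trivial summand: once one residuum is the whole ring,
    \<open>x\<close> splits as \<open>x\<close> plus zero, or as zero plus \<open>x\<close>.\<close>
  have zero_residuum: "\<zero> \<in> I \<rightharpoonup> J" if "ideal I R" "ideal J R" for I J
    using that by (auto simp: ideal_residuum_def ideal.Icarr additive_subgroup.zero_closed
        ideal.axioms(1))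
  fix I J assume IJ: "ideal I R" "ideal J R"
  consider "I \<subseteq> J" | "J \<subseteq> I" using ideals_total IJ by blast
  then show "set_add R (I \<rightharpoonup> J) (J \<rightharpoonup> I) = carrier R"
  proof cases
    case 1
    then have top: "I \<rightharpoonup> J = carrier R" using residuum_top IJ by blast
    have "x \<in> set_add R (I \<rightharpoonup> J) (J \<rightharpoonup> I)" if "x \<in> carrier R" for x
      using that zero_residuum[OF IJ(2,1)] unfolding set_add_def' top by force
    with residuum_closed show ?thesis by (auto simp: set_add_def')
  next
    case 2
    then have top: "J \<rightharpoonup> I = carrier R" using residuum_top IJ by blast
    have "x \<in> set_add R (I \<rightharpoonup> J) (J \<rightharpoonup> I)" if "x \<in> carrier R" for x
      using that zero_residuum[OF IJ] unfolding set_add_def' top by force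
    with residuum_closed show ?thesis by (auto simp: set_add_def')
  qed
qed

text \<open>Comparing principal ideals turns the order on ideals into divisibility of elements, set
  up for case distinctions.\<close>

lemma divides_total:
  assumes "x \<in> carrier R" "y \<in> carrier R"
  obtains r where "r \<in> carrier R" "x = y \<otimes> r" | r where "r \<in> carrier R" "y = x \<otimes> r"
proof -
  have "PIdl x \<subseteq> PIdl y \<or> PIdl y \<subseteq> PIdl x"
    using assms cgenideal_ideal ideals_total by blast
  then have "x \<in> PIdl y \<or> y \<in> PIdl x"
    using assms cgenideal_self by blast
  then show thesis
    using that assms by (auto simp: cgenideal_def m_comm)
qed

text \<open>One of \<open>x\<close> and \<open>1 - x\<close> divides the other, hence also their sum
  1, and so is a unit. A nonunit \<open>x\<close> leaves only \<open>1 - x\<close>.\<close>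

lemma one_minus_nonunit:
  assumes x: "x \<in> carrier R" "x \<notin> Units R"
  shows "\<one> \<ominus> x \<in> Units R"
proof -
  have split: "\<one> = x \<oplus> (\<one> \<ominus> x)" using x by algebra
  have unitI: "y \<in> Units R" if "y \<in> carrier R" "r \<in> carrier R" "\<one> = y \<otimes> r" for y r
    using that m_comm unfolding Units_def by auto
  have closed: "\<one> \<ominus> x \<in> carrier R" using x by simp
  from x(1) closed show ?thesis
  proof (cases rule: divides_total)
    case (1 r)
    then have "\<one> = (\<one> \<ominus> x) \<otimes> (r \<oplus> \<one>)" using split closed by (simp add: r_distr)
    then show ?thesis using unitI closed 1(1) by (meson a_closed one_closed)
  next
    case (2 r)
    have "x \<otimes> (\<one> \<oplus> r) = x \<oplus> x \<otimes> r" using x 2(1) by (simp add: r_distr)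
    with 2 split have "\<one> = x \<otimes> (\<one> \<oplus> r)" by simp
    then show ?thesis using unitI x 2(1) by (meson a_closed one_closed)
  qed
qed

text \<open>In \<open>i k + j l\<close> one of \<open>i\<close>, \<open>j\<close> divides the other
  and can be factored out; the quotient is absorbed by \<open>K\<close>. So finite sums of products
  collapse to one product.\<close>

lemma ideal_prod_single:
  assumes I: "ideal I R" and K: "ideal K R" and x: "x \<in> I \<cdot> K"
  shows "\<exists>i \<in> I. \<exists>k \<in> K. x = i \<otimes> k"
proof -
  interpret I: ideal I R by fact
  interpret K: ideal K R by fact
  show ?thesis
    using x
  proof (induction rule: ideal_prod.induct)
    case (prod i k)
    then show ?case by blast
  next
    case (sum x y)
    from sum.IH obtain i k where ik: "i \<in> I" "k \<in> K" "x = i \<otimes> k" by (elim bexE)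
    from sum.IH obtain j l where jl: "j \<in> I" "l \<in> K" "y = j \<otimes> l" by (elim bexE)
    note * = ik jl
    have carr: "i \<in> carrier R" "j \<in> carrier R" "k \<in> carrier R" "l \<in> carrier R"
      using * by (simp_all add: I.Icarr K.Icarr)
    from carr(1,2) show ?case
    proof (cases rule: divides_total)
      case (1 r)
      then have "x \<oplus> y = j \<otimes> (r \<otimes> k \<oplus> l)" using * carr by (simp add: r_distr m_assoc)
      moreover have "r \<otimes> k \<oplus> l \<in> K"
        using 1 * by (simp add: K.I_l_closed K.a_closed)
      ultimately show ?thesis using * by blast
    next
      case (2 r)
      then have "x \<oplus> y = i \<otimes> (k \<oplus> r \<otimes> l)" using * carr by (simp add: r_distr m_assoc)
      moreover have "k \<oplus> r \<otimes> l \<in> K"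
        using 2 * by (simp add: K.I_l_closed K.a_closed)
      ultimately show ?thesis using * by blast
    qed
  qed
qed

text \<open>Applied to each ideal of a BL-ring in turn, this makes all ideals principal and hence
  finitely generated.\<close>

lemma divisible_imp_principal:
  assumes I: "ideal I R"
    and divisible: "\<And>J. ideal J R \<Longrightarrow> I \<inter> J = I \<cdot> (I \<rightharpoonup> J)"
  shows "\<exists>i \<in> I. I = PIdl i"
proof (rule ccontr)
  assume nonprincipal: "\<not> (\<exists>i \<in> I. I = PIdl i)"
  interpret I: ideal I R by fact
  have proper: "\<exists>j \<in> I. j \<notin> PIdl i" if "i \<in> I" for i
    using that nonprincipal cgenideal_minimal[OF I that] by blast
  \<comment> \<open>An element of \<open>I\<close> outside \<open>PIdl\<close> of zero exists by
    \<open>proper\<close>, and it cannot be zero.\<close>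
  have "\<zero> \<in> PIdl \<zero>" by (simp add: cgenideal_self)
  then obtain a where a: "a \<in> I" "a \<noteq> \<zero>" using proper[OF I.zero_closed] by metis
  then have acarr: "a \<in> carrier R" by (simp add: I.Icarr)
  have Pa: "ideal (PIdl a) R" by (simp add: acarr cgenideal_ideal)
  have "a \<in> I \<cdot> (I \<rightharpoonup> (PIdl a))"
    using divisible[OF Pa] a cgenideal_self[OF acarr] by blast
  then obtain i k where ik: "i \<in> I" "k \<in> I \<rightharpoonup> (PIdl a)" "a = i \<otimes> k"
    using ideal_prod_single[OF I ideal_residuum_ideal[OF I Pa]] by blast
  obtain j where j: "j \<in> I" "j \<notin> PIdl i" using proper ik by blast
  have carr: "i \<in> carrier R" "j \<in> carrier R" "k \<in> carrier R"
    using ik j by (auto simp: ideal_residuum_def I.Icarr)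
  have notdvd: "j \<noteq> i \<otimes> r" if "r \<in> carrier R" for r
    using j(2) that carr m_comm[of i r] by (auto simp: cgenideal_def)
  \<comment> \<open>As \<open>i\<close> does not divide \<open>j\<close>, totality leaves only that
    \<open>j\<close> divides \<open>i\<close>.\<close>
  obtain m where m: "m \<in> carrier R" "i = j \<otimes> m"
    using carr(1,2) notdvd by (cases rule: divides_total) blast+
  have "k \<otimes> j \<in> PIdl a" using ik j by (auto simp: ideal_residuum_def)
  then obtain r where r: "r \<in> carrier R" "k \<otimes> j = r \<otimes> a" by (auto simp: cgenideal_def)
  \<comment> \<open>A factor of a unit is a unit, and an invertible \<open>m\<close> would make
    \<open>j\<close> a multiple of \<open>i\<close>, against the choice of \<open>j\<close>.\<close>
  have "m \<otimes> r \<notin> Units R"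
  proof
    assume "m \<otimes> r \<in> Units R"
    then have "m \<in> Units R" using unit_factor m r by blast
    then have "j = i \<otimes> inv m" using m carr by (simp add: m_assoc)
    then show False using notdvd \<open>m \<in> Units R\<close> by blast
  qed
  then have unit: "\<one> \<ominus> m \<otimes> r \<in> Units R" using one_minus_nonunit m r by blast
  have "a = m \<otimes> (k \<otimes> j)" using ik(3) m carr by (simp add: m_ac)
  then have "a = m \<otimes> r \<otimes> a" using r m acarr by (simp add: m_assoc)
  then have "(\<one> \<ominus> m \<otimes> r) \<otimes> a = \<zero>"
    \<comment> \<open>Zero divisors forbid cancelling \<open>a\<close> in \<open>a = m r a\<close>;
      instead the unit \<open>1 - m r\<close> is cancelled, which forces \<open>a\<close> to
      vanish.\<close>
    using m r acarr by (simp add: minus_eq l_distr l_minus r_neg)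
  then have "a = \<zero>"
    using unit acarr by (metis Units_closed Units_l_cancel r_null zero_closed)
  with a show False by blast
qed

end

theorem theorem5p7:
  fixes R :: "('a, 'm) ring_scheme" (structure)
  assumes "valuation_ring R"
    and "\<not> noetherian_ring R"
  shows "MTL_ring R \<and> \<not> BL_ring R"
proof
  interpret valuation_ring R by fact
  show "MTL_ring R" by (rule MTL_ring)
  show "\<not> BL_ring R"
  proof
    assume BL: "BL_ring R"
    have "noetherian_ring R"
    proof unfold_locales
      fix I assume I: "ideal I R"
      obtain i where i: "i \<in> I" "I = PIdl i"
        using divisible_imp_principal[OF I] BL_ring.divisible[OF BL I] by blast
      have "i \<in> carrier R" using I i(1) by (rule ideal.Icarr)
      with i(2) have "{i} \<subseteq> carrier R" "I = Idl {i}"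
        by (simp_all add: cgenideal_eq_genideal)
      then show "\<exists>A \<subseteq> carrier R. finite A \<and> I = Idl A" by blast
    qed
    with assms(2) show False by blast
  qed
qed

end
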